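(* If $\ell$ is a positive integer, then the third central moment of the crosscorrelation demerit factor over all pairs of binary sequences of length $\ell$ (uniformly distributed) is \[ \mu^\ell_{3,(f,g)} \mathrm{CDF}(f,g) = \frac{ 8\ell^4 - 32\ell^3 + 40\ell^2 - 16\ell }{\ell^6}. \]
   Context: A binary sequence of length $\ell$ is a doubly infinite list $f=(f_j)_{j\in\mathbb{Z}}$ with $f_j\in\{-1,1\}$ for $0\le j\le \ell-1$ and $f_j=0$ for all other $j$. For sequences $f,g$ of complex numbers with finitely many nonzero terms and $s\in\mathbb{Z}$, the aperiodic crosscorrelation is $C_{f,g}(s)=\sum_{j\in\mathbb{Z}} f_{j+s}\overline{g_j}$. For nonzero $f,g$, the crosscorrelation demerit factor is \[ \mathrm{CDF}(f,g)=\frac{\sum_{s\in\mathbb{Z}}|C_{f,g}(s)|^2}{C_{f,f}(0)\,C_{g,g}(0)}. \] $\mathrm{Pair}(\ell)$ is the set of all $2^{2\ell}$ ordered pairs $(f,g)$ of binary sequences of length $\ell$, with uniform probability measure; $\mathbb{E}^\ell_{(f,g)} v(f,g)$ is the expected value of a random variable $v$ with respect to this measure, and its $p$th central moment is $\mu^\ell_{p,(f,g)} v(f,g)=\mathbb{E}^\ell_{(f,g)}\bigl(v(f,g)-\mathbb{E}^\ell_{(f,g)}v(f,g)\bigr)^p$. *)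

theory Defs
  imports "HOL-Probability.Probability"
begin

definition binary_seq :: "nat \<Rightarrow> (int \<Rightarrow> complex) set" where
  "binary_seq l = {f. (\<forall>j. 0 \<le> j \<and> j \<le> int l - 1 \<longrightarrow> f j \<in> {-1, 1}) \<and>
                      (\<forall>j. \<not> (0 \<le> j \<and> j \<le> int l - 1) \<longrightarrow> f j = 0)}"

definition crosscorr :: "(int \<Rightarrow> complex) \<Rightarrow> (int \<Rightarrow> complex) \<Rightarrow> int \<Rightarrow> complex" where
  "crosscorr f g s = (\<Sum>\<^sub>\<infinity>j\<in>UNIV. f (j + s) * cnj (g j))"

text \<open>The autocorrelations at shift 0 are sums of squared moduli, hence real; taking their real
  parts makes the demerit factor real valued. The lemma \<open>of_real_CDF\<close> recovers the usual quotient.\<close>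

definition CDF :: "(int \<Rightarrow> complex) \<Rightarrow> (int \<Rightarrow> complex) \<Rightarrow> real" where
  "CDF f g = (\<Sum>\<^sub>\<infinity>s\<in>UNIV. (cmod (crosscorr f g s))\<^sup>2) /
             (Re (crosscorr f f 0) * Re (crosscorr g g 0))"

lemma crosscorr_self_0: "crosscorr f f 0 = complex_of_real (Re (crosscorr f f 0))"
proof -
  have "cnj (crosscorr f f 0) = crosscorr f f 0"
    unfolding crosscorr_def infsum_cnj[symmetric] by (simp add: mult.commute)
  then show ?thesis by (simp add: complex_eq_iff)
qed

lemma of_real_CDF:
  "complex_of_real (CDF f g) =
     complex_of_real (\<Sum>\<^sub>\<infinity>s\<in>UNIV. (cmod (crosscorr f g s))\<^sup>2) / (crosscorr f f 0 * crosscorr g g 0)"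
  by (subst (1 2) crosscorr_self_0) (simp add: CDF_def)

definition Pair_seq :: "nat \<Rightarrow> ((int \<Rightarrow> complex) \<times> (int \<Rightarrow> complex)) set" where
  "Pair_seq l = binary_seq l \<times> binary_seq l"

lemma bij_betw_binary_seq:
  "bij_betw (\<lambda>f. restrict f {0..<int l}) (binary_seq l) ({0..<int l} \<rightarrow>\<^sub>E {-1, 1})"
proof (rule bij_betwI[where g = "\<lambda>h j. if j \<in> {0..<int l} then h j else 0"])
  show "(\<lambda>f. restrict f {0..<int l}) \<in> binary_seq l \<rightarrow> ({0..<int l} \<rightarrow>\<^sub>E {-1, 1})"
    unfolding binary_seq_def by auto
  show "(\<lambda>h j. if j \<in> {0..<int l} then h j else 0) \<in> ({0..<int l} \<rightarrow>\<^sub>E {-1, 1}) \<rightarrow> binary_seq l"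
    unfolding binary_seq_def by (fastforce simp: PiE_def Pi_def)
  show "(\<lambda>j. if j \<in> {0..<int l} then restrict f {0..<int l} j else 0) = f"
    if "f \<in> binary_seq l" for f
    using that unfolding binary_seq_def by (intro ext) auto
  show "restrict (\<lambda>j. if j \<in> {0..<int l} then h j else 0) {0..<int l} = h"
    if "h \<in> {0..<int l} \<rightarrow>\<^sub>E {-1, 1}" for h
    using that by (intro ext) (auto simp: PiE_def extensional_def)
qed

lemma finite_binary_seq: "finite (binary_seq l)"
  using bij_betw_finite[OF bij_betw_binary_seq[of l]] by (simp add: finite_PiE)

lemma card_binary_seq: "card (binary_seq l) = 2 ^ l"
  using bij_betw_same_card[OF bij_betw_binary_seq[of l]] by (simp add: card_PiE numeral_2_eq_2)

lemma finite_Pair_seq: "finite (Pair_seq l)"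
  by (simp add: Pair_seq_def finite_binary_seq)

lemma card_Pair_seq: "card (Pair_seq l) = 2 ^ (2 * l)"
  by (simp add: Pair_seq_def card_cartesian_product card_binary_seq power_add[symmetric] mult_2)

lemma Pair_seq_nonempty: "Pair_seq l \<noteq> {}"
  using card_Pair_seq[of l] by auto

definition pair_expectation ::
    "nat \<Rightarrow> ((int \<Rightarrow> complex) \<Rightarrow> (int \<Rightarrow> complex) \<Rightarrow> real) \<Rightarrow> real" where
  "pair_expectation l v = measure_pmf.expectation (pmf_of_set (Pair_seq l)) (\<lambda>(f, g). v f g)"

definition pair_central_moment ::
    "nat \<Rightarrow> nat \<Rightarrow> ((int \<Rightarrow> complex) \<Rightarrow> (int \<Rightarrow> complex) \<Rightarrow> real) \<Rightarrow> real" where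
  "pair_central_moment p l v = pair_expectation l (\<lambda>f g. (v f g - pair_expectation l v) ^ p)"

end

theory Submission
  imports Defs
begin

text \<open>
  Sorting the terms of the squared crosscorrelations by the difference of the two \<open>f\<close>-indices gives
  \<open>CDF f g = 1 + 2 / l\<^sup>2 * (\<Sum>s = 1..<l. A\<^sub>f(s) A\<^sub>g(s))\<close> with the aperiodic autocorrelations \<open>A\<close>.
  Since \<open>A\<^sub>f(s)\<close> has mean zero, \<open>CDF\<close> has mean one, and by independence of \<open>f\<close> and \<open>g\<close> the third
  central moment is \<open>8 / l^6\<close> times the sum of \<open>E(A(s) A(t) A(u))\<^sup>2\<close> over all shifts.
  A product of six signs \<open>f\<^sub>i f\<^sub>i\<^sub>+\<^sub>s f\<^sub>j f\<^sub>j\<^sub>+\<^sub>t f\<^sub>k f\<^sub>k\<^sub>+\<^sub>u\<close> has nonzero mean only if the three edges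
  \<open>{i, i + s}\<close>, \<open>{j, j + t}\<close>, \<open>{k, k + u}\<close> form a triangle, so one shift is the sum of the other
  two; if \<open>u = s + t < l\<close> there are exactly \<open>2 (l - u)\<close> such triangles.
\<close>

section \<open>Real signs, autocorrelations and crosscorrelations as finite sums\<close>

definition sign_at :: "(int \<Rightarrow> complex) \<Rightarrow> nat \<Rightarrow> real" where
  "sign_at f n = Re (f (int n))"

text \<open>For a binary sequence this is the value of \<open>crosscorr f f s\<close> at a
  nonnegative shift; truncated subtraction leaves an empty sum for shifts of \<open>l\<close> or
  more.\<close>

definition autocorr :: "nat \<Rightarrow> (int \<Rightarrow> complex) \<Rightarrow> nat \<Rightarrow> real" where
  "autocorr l f s = (\<Sum>j<l - s. sign_at f j * sign_at f (j + s))"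

lemma binary_seq_values:
  "f \<in> binary_seq l \<Longrightarrow> n < l \<Longrightarrow> f (int n) = -1 \<or> f (int n) = 1"
  by (simp add: binary_seq_def)

lemma binary_seq_of_real:
  "f \<in> binary_seq l \<Longrightarrow> n < l \<Longrightarrow> f (int n) = complex_of_real (sign_at f n)"
  using binary_seq_values[of f l n] by (auto simp: sign_at_def)

lemma sign_at_square:
  "f \<in> binary_seq l \<Longrightarrow> n < l \<Longrightarrow> sign_at f n * sign_at f n = 1"
  using binary_seq_values[of f l n] by (auto simp: sign_at_def)

lemma binary_seq_outside:
  "f \<in> binary_seq l \<Longrightarrow> j < 0 \<or> int l \<le> j \<Longrightarrow> f j = 0"
  by (auto simp: binary_seq_def)

lemma binary_seqI:
  assumes "\<And>n. n < l \<Longrightarrow> f (int n) = -1 \<or> f (int n) = 1"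
    and "\<And>j. j < 0 \<or> int l \<le> j \<Longrightarrow> f j = 0"
  shows "f \<in> binary_seq l"
proof -
  have "f j \<in> {-1, 1}" if "0 \<le> j" "j \<le> int l - 1" for j
    using assms(1)[of "nat j"] that by simp
  moreover have "f j = 0" if "\<not> (0 \<le> j \<and> j \<le> int l - 1)" for j
    using that by (intro assms(2)) auto
  ultimately show ?thesis by (auto simp: binary_seq_def)
qed

text \<open>Keeping the shift as a condition inside a full square gives ranges that do not depend on
  \<open>s\<close>, so the square of the sum can be expanded and reordered freely.\<close>

lemma crosscorr_binary:
  assumes f: "f \<in> binary_seq l" and g: "g \<in> binary_seq l"
  shows "crosscorr f g s =
    of_real (\<Sum>a<l. \<Sum>b<l. if int a = int b + s then sign_at f a * sign_at g b else 0)"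
proof -
  have "crosscorr f g s = (\<Sum>\<^sub>\<infinity>j\<in>int ` {..<l}. f (j + s) * cnj (g j))"
    unfolding crosscorr_def
  proof (rule infsum_cong_neutral)
    fix j assume "j \<in> UNIV - int ` {..<l}"
    then have "j < 0 \<or> int l \<le> j"
      by (metis DiffE image_eqI lessThan_iff nat_int not_le zero_le_imp_eq_int of_nat_less_iff)
    then show "f (j + s) * cnj (g j) = 0"
      using binary_seq_outside[OF g] by simp
  qed auto
  also have "\<dots> = (\<Sum>b<l. f (int b + s) * cnj (g (int b)))"
    by (simp add: sum.reindex)
  also have "\<dots> = (\<Sum>b<l. of_real (\<Sum>a<l. if int a = int b + s then sign_at f a * sign_at g b else 0))"
  proof (rule sum.cong)
    fix b assume "b \<in> {..<l}"
    then have b: "b < l" by simp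
    show "f (int b + s) * cnj (g (int b)) =
      of_real (\<Sum>a<l. if int a = int b + s then sign_at f a * sign_at g b else 0)"
    proof (cases "0 \<le> int b + s \<and> int b + s < int l")
      case True
      then obtain c where c: "int b + s = int c" "c < l"
        by (metis zero_le_imp_eq_int of_nat_less_iff)
      show ?thesis
        using c b by (simp add: binary_seq_of_real[OF f] binary_seq_of_real[OF g])
    next
      case False
      then have "f (int b + s) = 0" using binary_seq_outside[OF f] by auto
      moreover have "int a \<noteq> int b + s" if "a < l" for a using False that by auto
      ultimately show ?thesis by simp
    qed
  qed simp
  also have "\<dots> = of_real (\<Sum>a<l. \<Sum>b<l. if int a = int b + s then sign_at f a * sign_at g b else 0)"
    by (subst sum.swap) simp
  finally show ?thesis .
qed

section \<open>The demerit factor in terms of autocorrelations\<close>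

lemma crosscorr_self_0_binary:
  assumes "f \<in> binary_seq l"
  shows "crosscorr f f 0 = of_nat l"
  using sign_at_square[OF assms] by (simp add: crosscorr_binary[OF assms assms])

text \<open>The square splits into its main diagonal and the pairs of off-diagonals at distance
  \<open>s\<close>. Enlarging \<open>l\<close> by one adds exactly one pair of entries,
  \<open>(l - s, l)\<close> and its mirror image, at each distance.\<close>

lemma sum_by_difference:
  fixes h :: "nat \<Rightarrow> nat \<Rightarrow> 'a::comm_monoid_add"
  shows "(\<Sum>a<l. \<Sum>c<l. h a c) =
    (\<Sum>a<l. h a a) + (\<Sum>s = 1..<l. \<Sum>a<l - s. h a (a + s) + h (a + s) a)"
proof (induction l)
  case (Suc l)
  have "(\<Sum>s = 1..<Suc l. \<Sum>a<Suc l - s. h a (a + s) + h (a + s) a) =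
      (\<Sum>s = 1..<Suc l. (\<Sum>a<l - s. h a (a + s) + h (a + s) a) + (h (l - s) l + h l (l - s)))"
    by (rule sum.cong) (auto simp: Suc_diff_le)
  also have "\<dots> = (\<Sum>s = 1..<Suc l. \<Sum>a<l - s. h a (a + s) + h (a + s) a) +
      (\<Sum>s = 1..<Suc l. h (l - s) l + h l (l - s))"
    by (rule sum.distrib)
  also have "(\<Sum>s = 1..<Suc l. \<Sum>a<l - s. h a (a + s) + h (a + s) a) =
      (\<Sum>s = 1..<l. \<Sum>a<l - s. h a (a + s) + h (a + s) a)"
    by (cases l) auto
  also have "(\<Sum>s = 1..<Suc l. h (l - s) l + h l (l - s)) = (\<Sum>a<l. h a l + h l a)"
    by (rule sum.reindex_bij_witness[of _ "\<lambda>a. l - a" "\<lambda>s. l - s"]) auto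
  finally show ?case
    by (simp add: Suc.IH sum.distrib ac_simps)
qed simp

lemma sum_shifted_diagonal:
  "(\<Sum>b<l. \<Sum>d<l. if d = b + s then g b d else 0) = (\<Sum>b<l - s. g b (b + s))"
  for g :: "nat \<Rightarrow> nat \<Rightarrow> 'a::comm_monoid_add"
proof -
  have "(\<Sum>b<l. \<Sum>d<l. if d = b + s then g b d else 0) = (\<Sum>b<l. if b + s < l then g b (b + s) else 0)"
    by simp
  also have "\<dots> = (\<Sum>b\<in>{..<l} \<inter> {b. b + s < l}. g b (b + s))"
    by (simp add: sum.inter_restrict)
  also have "{..<l} \<inter> {b. b + s < l} = {..<l - s}" by auto
  finally show ?thesis .
qed

lemma sum_square_crosscorr:
  assumes f: "f \<in> binary_seq l" and g: "g \<in> binary_seq l"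
  shows "(\<Sum>\<^sub>\<infinity>s\<in>UNIV. (cmod (crosscorr f g s))\<^sup>2) =
    (real l)\<^sup>2 + 2 * (\<Sum>s = 1..<l. autocorr l f s * autocorr l g s)"
proof -
  let ?F = "sign_at f" and ?G = "sign_at g" and ?S = "{- int l<..<int l}"
  define c where
    "c s = (\<Sum>a<l. \<Sum>b<l. if int a = int b + s then ?F a * ?G b else 0)" for s
  have cr: "crosscorr f g s = of_real (c s)" for s
    unfolding c_def by (rule crosscorr_binary[OF f g])
  have c0: "c s = 0" if "s \<notin> ?S" for s
    unfolding c_def using that by (intro sum.neutral ballI) auto
  \<comment> \<open>\<open>h a c\<close> collects the terms with \<open>f\<close>-indices
    \<open>a\<close> and \<open>c\<close>. The requirement that \<open>a - b\<close> and
    \<open>c - d\<close> are the same shift is written additively to avoid truncated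
    subtraction.\<close>
  define h where
    "h a c = ?F a * ?F c * (\<Sum>b<l. \<Sum>d<l. if a + d = b + c then ?G b * ?G d else 0)" for a c
  have "(\<Sum>\<^sub>\<infinity>s\<in>UNIV. (cmod (crosscorr f g s))\<^sup>2) = (\<Sum>\<^sub>\<infinity>s\<in>?S. (c s)\<^sup>2)"
    by (rule infsum_cong_neutral) (auto simp: cr c0)
  also have "\<dots> = (\<Sum>s\<in>?S. (c s)\<^sup>2)" by simp
  also have "\<dots> = (\<Sum>s\<in>?S. \<Sum>a<l. \<Sum>c<l. \<Sum>b<l. \<Sum>d<l.
      if s = int a - int b then if a + d = b + c then ?F a * ?F c * (?G b * ?G d) else 0 else 0)"
    unfolding power2_eq_square c_def sum_product
    by (intro sum.cong refl) auto
  also have "\<dots> = (\<Sum>a<l. \<Sum>c<l. \<Sum>b<l. \<Sum>d<l. \<Sum>s\<in>?S.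
      if s = int a - int b then if a + d = b + c then ?F a * ?F c * (?G b * ?G d) else 0 else 0)"
    by (simp only: sum.swap[of _ _ ?S])
  \<comment> \<open>Each pair \<open>a\<close>, \<open>b\<close> determines one shift, and it lies
    in the window \<open>?S\<close>, so the sum over shifts collapses.\<close>
  also have "\<dots> = (\<Sum>a<l. \<Sum>c<l. h a c)"
    unfolding h_def sum_distrib_left by (intro sum.cong refl) auto
  also have "\<dots> = (\<Sum>a<l. h a a) + (\<Sum>s = 1..<l. \<Sum>a<l - s. h a (a + s) + h (a + s) a)"
    by (rule sum_by_difference)
  also have "(\<Sum>a<l. h a a) = (real l)\<^sup>2"
    by (simp add: h_def sign_at_square[OF f] sign_at_square[OF g] power2_eq_square)
  also have "(\<Sum>s = 1..<l. \<Sum>a<l - s. h a (a + s) + h (a + s) a) =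
      (\<Sum>s = 1..<l. 2 * (autocorr l f s * autocorr l g s))"
  proof (intro sum.cong refl)
    fix s
    have "h a (a + s) = ?F a * ?F (a + s) * autocorr l g s" for a
      using sum_shifted_diagonal[where l = l and s = s and g = "\<lambda>b d. ?G b * ?G d"]
      by (simp add: h_def autocorr_def add.commute add.left_commute)
    \<comment> \<open>Here the condition reads \<open>b = d + s\<close>, the mirror image of
      \<open>d = b + s\<close>; the two orders of the \<open>f\<close>-indices give the same value,
      hence the factor 2.\<close>
    moreover have "h (a + s) a = ?F a * ?F (a + s) * autocorr l g s" for a
    proof -
      have "(\<Sum>b<l. \<Sum>d<l. if a + s + d = b + a then ?G b * ?G d else 0) =
          (\<Sum>d<l. \<Sum>b<l. if b = d + s then ?G d * ?G b else 0)"
        by (subst sum.swap) (intro sum.cong refl, auto)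
      then show ?thesis
        using sum_shifted_diagonal[where l = l and s = s and g = "\<lambda>b d. ?G b * ?G d"]
        by (simp add: h_def autocorr_def)
    qed
    ultimately show "(\<Sum>a<l - s. h a (a + s) + h (a + s) a) = 2 * (autocorr l f s * autocorr l g s)"
      by (simp add: autocorr_def[of l f] sum_distrib_right sum_distrib_left ac_simps)
  qed
  finally show ?thesis by (simp add: sum_distrib_left)
qed

lemma CDF_binary:
  assumes "f \<in> binary_seq l" and "g \<in> binary_seq l" and "l > 0"
  shows "CDF f g = 1 + 2 / (real l)\<^sup>2 * (\<Sum>s = 1..<l. autocorr l f s * autocorr l g s)"
  using assms
  unfolding CDF_def sum_square_crosscorr[OF assms(1,2)]
  by (simp add: crosscorr_self_0_binary add_divide_distrib power2_eq_square)

section \<open>Averages of products of signs\<close>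

lemma sum_sign_prod:
  assumes "S \<subseteq> {..<l}"
  shows "(\<Sum>f\<in>binary_seq l. \<Prod>n\<in>S. sign_at f n) = (if S = {} then 2 ^ l else 0)"
proof (cases "S = {}")
  case True
  then show ?thesis by (simp add: card_binary_seq)
next
  case False
  then obtain p where p: "p \<in> S" by auto
  \<comment> \<open>Flipping the sign at one position of \<open>S\<close> is an involution on
    \<open>binary_seq l\<close> that negates the product, so the sum equals its own
    negative.\<close>
  let ?flip = "\<lambda>f. f(int p := - f (int p)) :: int \<Rightarrow> complex"
  have fin: "finite S" using assms finite_subset by blast
  have flip: "(\<Prod>n\<in>S. sign_at (?flip f) n) = - (\<Prod>n\<in>S. sign_at f n)" for f
  proof -
    have "(\<Prod>n\<in>S - {p}. sign_at (?flip f) n) = (\<Prod>n\<in>S - {p}. sign_at f n)"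
      by (rule prod.cong) (auto simp: sign_at_def)
    then show ?thesis
      using p fin by (simp add: prod.remove[of S p] sign_at_def)
  qed
  have p_less: "p < l" using p assms by auto
  have flip_mem: "?flip f \<in> binary_seq l" if "f \<in> binary_seq l" for f
  proof (rule binary_seqI)
    show "?flip f (int n) = -1 \<or> ?flip f (int n) = 1" if "n < l" for n
      using binary_seq_values[OF \<open>f \<in> binary_seq l\<close> that] by auto
    show "?flip f j = 0" if "j < 0 \<or> int l \<le> j" for j
      using binary_seq_outside[OF \<open>f \<in> binary_seq l\<close> that] p_less that by auto
  qed
  have "(\<Sum>f\<in>binary_seq l. \<Prod>n\<in>S. sign_at f n) =
      (\<Sum>f\<in>binary_seq l. \<Prod>n\<in>S. sign_at (?flip f) n)"
    by (intro sum.reindex_bij_witness[of _ ?flip ?flip]) (simp_all add: flip_mem)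
  also have "\<dots> = - (\<Sum>f\<in>binary_seq l. \<Prod>n\<in>S. sign_at f n)"
    by (simp only: flip sum_negf)
  finally show ?thesis using False by simp
qed

text \<open>Signs at shared positions square to one. This reduces a product with repeated indices to
  one over distinct indices, whose average is known from \<open>sum_sign_prod\<close>.\<close>

lemma sign_prod_mult:
  assumes f: "f \<in> binary_seq l" and "S \<subseteq> {..<l}" and "T \<subseteq> {..<l}"
  shows "(\<Prod>n\<in>S. sign_at f n) * (\<Prod>n\<in>T. sign_at f n) = (\<Prod>n\<in>sym_diff S T. sign_at f n)"
proof -
  have fin: "finite S" "finite T" using assms finite_subset by blast+
  have "(\<Prod>n\<in>S. sign_at f n) = (\<Prod>n\<in>S - T. sign_at f n) * (\<Prod>n\<in>S \<inter> T. sign_at f n)"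
    using fin by (subst prod.union_disjoint[symmetric]) (auto intro: prod.cong)
  moreover have "(\<Prod>n\<in>T. sign_at f n) = (\<Prod>n\<in>T - S. sign_at f n) * (\<Prod>n\<in>S \<inter> T. sign_at f n)"
    using fin by (subst prod.union_disjoint[symmetric]) (auto intro: prod.cong)
  moreover have "(\<Prod>n\<in>S \<inter> T. sign_at f n) * (\<Prod>n\<in>S \<inter> T. sign_at f n) = 1"
    using assms by (subst prod.distrib[symmetric]) (auto intro!: prod.neutral sign_at_square[OF f])
  moreover have "(\<Prod>n\<in>sym_diff S T. sign_at f n) =
      (\<Prod>n\<in>S - T. sign_at f n) * (\<Prod>n\<in>T - S. sign_at f n)"
    using fin by (intro prod.union_disjoint) auto
  ultimately show ?thesis by (simp add: ac_simps)
qed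

section \<open>First and third moments of the autocorrelations\<close>

lemma sum_autocorr:
  assumes "s > 0"
  shows "(\<Sum>f\<in>binary_seq l. autocorr l f s) = 0"
proof -
  have "(\<Sum>f\<in>binary_seq l. autocorr l f s) =
      (\<Sum>j<l - s. \<Sum>f\<in>binary_seq l. \<Prod>n\<in>{j, j + s}. sign_at f n)"
    using assms unfolding autocorr_def by (subst sum.swap) simp
  also have "\<dots> = (\<Sum>j<l - s. 0)"
    by (intro sum.cong refl, subst sum_sign_prod) auto
  finally show ?thesis by simp
qed

text \<open>The symmetric difference is empty exactly when each index lies in an even number of the
  three edges, so that all signs cancel. For positive shifts the edges are genuine doubletons and
  this forces a triangle.\<close>

definition forms_triangle :: "nat \<Rightarrow> nat \<Rightarrow> nat \<Rightarrow> nat \<Rightarrow> nat \<Rightarrow> nat \<Rightarrow> bool" where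
  "forms_triangle s t u i j k \<longleftrightarrow> sym_diff (sym_diff {i, i + s} {j, j + t}) {k, k + u} = {}"

definition triple_moment :: "nat \<Rightarrow> nat \<Rightarrow> nat \<Rightarrow> nat \<Rightarrow> real" where
  "triple_moment l s t u = (\<Sum>f\<in>binary_seq l. autocorr l f s * autocorr l f t * autocorr l f u) / 2 ^ l"

text \<open>After expansion each product of six signs averages to 1 or 0, so the moment counts
  triangles with prescribed side lengths.\<close>

lemma triple_moment_eq:
  assumes "s > 0" "t > 0" "u > 0"
  shows "triple_moment l s t u =
    (\<Sum>i<l - s. \<Sum>j<l - t. \<Sum>k<l - u. if forms_triangle s t u i j k then 1 else 0)"
proof -
  have signs: "(\<Sum>f\<in>binary_seq l. sign_at f i * sign_at f (i + s) *
      (sign_at f j * sign_at f (j + t)) * (sign_at f k * sign_at f (k + u))) =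
      2 ^ l * (if forms_triangle s t u i j k then 1 else 0)"
    if "i < l - s" "j < l - t" "k < l - u" for i j k
  proof -
    have sub: "{i, i + s} \<subseteq> {..<l}" "{j, j + t} \<subseteq> {..<l}" "{k, k + u} \<subseteq> {..<l}"
      using that by auto
    then have sub2: "sym_diff {i, i + s} {j, j + t} \<subseteq> {..<l}" by blast
    have "(\<Sum>f\<in>binary_seq l. sign_at f i * sign_at f (i + s) *
        (sign_at f j * sign_at f (j + t)) * (sign_at f k * sign_at f (k + u))) =
      (\<Sum>f\<in>binary_seq l. (\<Prod>n\<in>{i, i + s}. sign_at f n) *
        (\<Prod>n\<in>{j, j + t}. sign_at f n) * (\<Prod>n\<in>{k, k + u}. sign_at f n))"
      using assms by simp
    also have "\<dots> = (\<Sum>f\<in>binary_seq l.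
        \<Prod>n\<in>sym_diff (sym_diff {i, i + s} {j, j + t}) {k, k + u}. sign_at f n)"
      using sub sub2 by (intro sum.cong refl) (simp only: sign_prod_mult)
    also have "\<dots> = (if forms_triangle s t u i j k then 2 ^ l else 0)"
      unfolding forms_triangle_def using sub sub2 by (intro sum_sign_prod) blast
    finally show ?thesis by simp
  qed
  have "(\<Sum>f\<in>binary_seq l. autocorr l f s * autocorr l f t * autocorr l f u) =
      (\<Sum>f\<in>binary_seq l. \<Sum>i<l - s. \<Sum>j<l - t. \<Sum>k<l - u. sign_at f i * sign_at f (i + s) *
      (sign_at f j * sign_at f (j + t)) * (sign_at f k * sign_at f (k + u)))"
    unfolding autocorr_def
    by (simp only: sum_distrib_right mult.assoc) (simp only: sum_product sum_distrib_left mult.assoc)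
  also have "\<dots> = (\<Sum>i<l - s. \<Sum>j<l - t. \<Sum>k<l - u. \<Sum>f\<in>binary_seq l.
      sign_at f i * sign_at f (i + s) *
      (sign_at f j * sign_at f (j + t)) * (sign_at f k * sign_at f (k + u)))"
    by (simp only: sum.swap[of _ _ "binary_seq l"])
  also have "\<dots> = (\<Sum>i<l - s. \<Sum>j<l - t. \<Sum>k<l - u. 2 ^ l * (if forms_triangle s t u i j k then 1 else 0))"
    by (intro sum.cong refl signs) auto
  also have "\<dots> = 2 ^ l * (\<Sum>i<l - s. \<Sum>j<l - t. \<Sum>k<l - u. if forms_triangle s t u i j k then 1 else 0)"
    by (simp only: sum_distrib_left)
  finally show ?thesis by (simp add: triple_moment_def)
qed

text \<open>The third edge must be the symmetric difference of the first two. That set has two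
  elements only if these share exactly one vertex, and the four disjuncts name the shared
  vertex.\<close>

lemma sym_diff_doubletons_eq_empty_iff:
  fixes a b c d e f :: 'a
  assumes "a \<noteq> b" "c \<noteq> d" "e \<noteq> f"
  shows "sym_diff (sym_diff {a, b} {c, d}) {e, f} = {} \<longleftrightarrow>
    (a = c \<and> {e, f} = {b, d}) \<or> (a = d \<and> {e, f} = {b, c}) \<or>
    (b = c \<and> {e, f} = {a, d}) \<or> (b = d \<and> {e, f} = {a, c})"
proof -
  consider "a = c" "b = d" | "a = c" "b \<noteq> d" | "a = d" "b = c" | "a = d" "b \<noteq> c"
    | "b = c" "a \<noteq> d" | "b = d" "a \<noteq> c" | "a \<noteq> c" "a \<noteq> d" "b \<noteq> c" "b \<noteq> d"
    by blast
  then have "{e, f} = sym_diff {a, b} {c, d} \<longleftrightarrow>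
    (a = c \<and> {e, f} = {b, d}) \<or> (a = d \<and> {e, f} = {b, c}) \<or>
    (b = c \<and> {e, f} = {a, d}) \<or> (b = d \<and> {e, f} = {a, c})"
  proof cases
    case 1
    then have "sym_diff {a, b} {c, d} = {}" using assms by auto
    then show ?thesis using 1 assms by (auto simp: doubleton_eq_iff)
  next
    case 2
    then have "sym_diff {a, b} {c, d} = {b, d}" using assms by auto
    then show ?thesis using 2 assms by (auto simp: doubleton_eq_iff)
  next
    case 3
    then have "sym_diff {a, b} {c, d} = {}" using assms by auto
    then show ?thesis using 3 assms by (auto simp: doubleton_eq_iff)
  next
    case 4
    then have "sym_diff {a, b} {c, d} = {b, c}" using assms by auto
    then show ?thesis using 4 assms by (auto simp: doubleton_eq_iff)
  next
    case 5
    then have "sym_diff {a, b} {c, d} = {a, d}" using assms by auto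
    then show ?thesis using 5 assms by (auto simp: doubleton_eq_iff)
  next
    case 6
    then have "sym_diff {a, b} {c, d} = {a, c}" using assms by auto
    then show ?thesis using 6 assms by (auto simp: doubleton_eq_iff)
  next
    case 7
    then have *: "sym_diff {a, b} {c, d} = {a, b, c, d}" by auto
    \<comment> \<open>Disjoint edges leave four endpoints, too many for a single edge.\<close>
    have card: "card {a, b, c, d} = 4" "card {e, f} = 2" using 7 assms by simp_all
    have "{e, f} \<noteq> {a, b, c, d}"
    proof
      assume "{e, f} = {a, b, c, d}"
      then have "card {e, f} = card {a, b, c, d}" by (rule arg_cong)
      with card show False by linarith
    qed
    then show ?thesis unfolding * using 7 by simp
  qed
  moreover have "sym_diff S T = {} \<longleftrightarrow> T = S" for S T :: "'a set"
    by blast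
  ultimately show ?thesis by (simp only:)
qed

lemma forms_triangle_iff:
  assumes "s > 0" "t > 0" "u > 0"
  shows "forms_triangle s t u i j k \<longleftrightarrow>
    (i = j \<and> {k, k + u} = {i + s, j + t}) \<or> (i = j + t \<and> {k, k + u} = {i + s, j}) \<or>
    (i + s = j \<and> {k, k + u} = {i, j + t}) \<or> (i + s = j + t \<and> {k, k + u} = {i, j})"
  unfolding forms_triangle_def using assms by (intro sym_diff_doubletons_eq_empty_iff) auto

text \<open>The vertices lie on a line, so the longest side is the sum of the other two.\<close>

lemma forms_triangle_shifts:
  assumes "forms_triangle s t u i j k" "s > 0" "t > 0" "u > 0"
  shows "u = s + t \<or> s = t + u \<or> t = u + s"
  using assms(1) unfolding forms_triangle_iff[OF assms(2-)] doubleton_eq_iff by linarith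

text \<open>The longest side runs from \<open>k\<close> to \<open>k + s + t\<close>; the two shorter
  sides fill it in one of two orders.\<close>

lemma forms_triangle_long:
  assumes "s > 0" "t > 0"
  shows "forms_triangle s t (s + t) i j k \<longleftrightarrow> (i = k \<and> j = k + s) \<or> (j = k \<and> i = k + t)"
  using assms by (subst forms_triangle_iff) (auto simp: doubleton_eq_iff)

lemma triple_moment_long:
  assumes "s > 0" "t > 0"
  shows "triple_moment l s t (s + t) = 2 * real (l - (s + t))"
proof -
  have "triple_moment l s t (s + t) = (\<Sum>k<l - (s + t). \<Sum>i<l - s. \<Sum>j<l - t.
      if forms_triangle s t (s + t) i j k then 1 else 0)"
    using assms by (simp add: triple_moment_eq sum.swap[of _ "{..<l - (s + t)}"])
  also have "\<dots> = (\<Sum>k<l - (s + t). 2)"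
  proof (rule sum.cong)
    fix k assume "k \<in> {..<l - (s + t)}"
    then have k: "k + s + t < l" by auto
    \<comment> \<open>The two orders exclude each other because \<open>t > 0\<close>, so the
      indicator is a sum, even when \<open>s = t\<close>.\<close>
    have "(if forms_triangle s t (s + t) i j k then 1 else 0 :: real) =
        (if i = k then if j = k + s then 1 else 0 else 0) +
        (if i = k + t then if j = k then 1 else 0 else 0)" for i j
      using assms by (auto simp: forms_triangle_long)
    then have "(\<Sum>i<l - s. \<Sum>j<l - t. if forms_triangle s t (s + t) i j k then 1 else 0 :: real) =
        (\<Sum>i<l - s. \<Sum>j<l - t. if i = k then if j = k + s then 1 else 0 else 0) +
        (\<Sum>i<l - s. \<Sum>j<l - t. if i = k + t then if j = k then 1 else 0 else 0)"
      by (simp only: sum.distrib)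
    also have "\<dots> = (\<Sum>i<l - s. if i = k then (\<Sum>j<l - t. if j = k + s then 1 else 0) else 0) +
        (\<Sum>i<l - s. if i = k + t then (\<Sum>j<l - t. if j = k then 1 else 0) else 0)"
      by (intro arg_cong2[where f = "(+)"] sum.cong refl) simp_all
    \<comment> \<open>Both triangles fit into the index ranges because
      \<open>k + s + t < l\<close>.\<close>
    also have "\<dots> = 2" using k by (simp add: less_diff_conv)
    finally show "(\<Sum>i<l - s. \<Sum>j<l - t. if forms_triangle s t (s + t) i j k then 1 else 0 :: real) = 2" .
  qed simp
  finally show ?thesis by simp
qed

lemma triple_moment_rotate: "triple_moment l s t u = triple_moment l t u s"
  by (simp add: triple_moment_def ac_simps)

text \<open>For positive shifts at most one of the three conditions holds; rotation moves the
  longest shift to the last place, where \<open>triple_moment_long\<close> applies.\<close>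

lemma triple_moment_square:
  assumes "s > 0" "t > 0" "u > 0"
  shows "(triple_moment l s t u)\<^sup>2 =
    (if u = s + t then 4 * (real (l - u))\<^sup>2 else 0) +
    (if s = t + u then 4 * (real (l - s))\<^sup>2 else 0) +
    (if t = u + s then 4 * (real (l - t))\<^sup>2 else 0)"
proof -
  consider "u = s + t" | "s = t + u" | "t = u + s" | "u \<noteq> s + t" "s \<noteq> t + u" "t \<noteq> u + s"
    by blast
  then show ?thesis
  proof cases
    case 1
    then show ?thesis using assms by (simp add: triple_moment_long power_mult_distrib)
  next
    case 2
    then have "triple_moment l s t u = 2 * real (l - s)"
      using assms by (simp only: triple_moment_rotate[of l "t + u"] triple_moment_long)
    then show ?thesis using assms 2 by (simp add: power_mult_distrib)
  next
    case 3
    then have "triple_moment l s t u = 2 * real (l - t)"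
      using assms triple_moment_rotate[of l u s "u + s"] triple_moment_long[of u s l] by simp
    then show ?thesis using assms 3 by (simp add: power_mult_distrib)
  next
    case 4
    then have "\<not> forms_triangle s t u i j k" for i j k
      using forms_triangle_shifts assms by blast
    then show ?thesis using assms 4 by (simp add: triple_moment_eq)
  qed
qed

section \<open>Summation over the shifts\<close>

lemma sum_squares_below:
  "(\<Sum>k = 1..<m. (real k)\<^sup>2) = (real m - 1) * real m * (2 * real m - 1) / 6"
  by (induction m) (auto simp: field_simps power2_eq_square)

text \<open>Substituting \<open>m = l - s\<close> and then \<open>k = m - t\<close> turns this into
  a sum of sums of squares.\<close>

lemma sum_squares_pairs:
  "(\<Sum>s = 1..<l. \<Sum>t = 1..<l - s. (real (l - (s + t)))\<^sup>2) =
    real l * (real l - 1)\<^sup>2 * (real l - 2) / 12"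
proof -
  have "(\<Sum>s = 1..<l. \<Sum>t = 1..<l - s. (real (l - (s + t)))\<^sup>2) =
      (\<Sum>m = 1..<l. \<Sum>k = 1..<m. (real k)\<^sup>2)"
  proof (rule sum.reindex_bij_witness[of _ "\<lambda>m. l - m" "\<lambda>s. l - s"])
    fix s assume "s \<in> {1..<l}"
    show "(\<Sum>k = 1..<l - s. (real k)\<^sup>2) = (\<Sum>t = 1..<l - s. (real (l - (s + t)))\<^sup>2)"
      by (rule sum.reindex_bij_witness[of _ "\<lambda>t. l - s - t" "\<lambda>k. l - s - k"]) auto
  qed auto
  also have "\<dots> = real l * (real l - 1)\<^sup>2 * (real l - 2) / 12"
    unfolding sum_squares_below
    by (induction l) (auto simp: field_simps power2_eq_square)
  finally show ?thesis .
qed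

text \<open>The three choices of the longest shift contribute equally after renaming, and the
  constants cancel: three cases, a factor 4 from the squared moment, and the denominator 12.\<close>

lemma sum_triple_moment_square:
  "(\<Sum>s = 1..<l. \<Sum>t = 1..<l. \<Sum>u = 1..<l. (triple_moment l s t u)\<^sup>2) =
    real l * (real l - 1)\<^sup>2 * (real l - 2)"
proof -
  let ?N = "{1..<l}"
  define g where "g s t u = (if u = s + t then 4 * (real (l - u))\<^sup>2 else 0)" for s t u :: nat
  have "(\<Sum>s\<in>?N. \<Sum>t\<in>?N. \<Sum>u\<in>?N. (triple_moment l s t u)\<^sup>2) =
      (\<Sum>s\<in>?N. \<Sum>t\<in>?N. \<Sum>u\<in>?N. g s t u + g t u s + g u s t)"
    by (intro sum.cong refl) (auto simp: triple_moment_square g_def)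
  also have "\<dots> = (\<Sum>s\<in>?N. \<Sum>t\<in>?N. \<Sum>u\<in>?N. g s t u) + (\<Sum>s\<in>?N. \<Sum>t\<in>?N. \<Sum>u\<in>?N. g t u s) +
      (\<Sum>s\<in>?N. \<Sum>t\<in>?N. \<Sum>u\<in>?N. g u s t)"
    by (simp only: sum.distrib)
  also have "(\<Sum>s\<in>?N. \<Sum>t\<in>?N. \<Sum>u\<in>?N. g t u s) = (\<Sum>t\<in>?N. \<Sum>u\<in>?N. \<Sum>s\<in>?N. g t u s)"
    by (subst sum.swap) (intro sum.cong refl sum.swap)
  also have "(\<Sum>s\<in>?N. \<Sum>t\<in>?N. \<Sum>u\<in>?N. g u s t) = (\<Sum>u\<in>?N. \<Sum>s\<in>?N. \<Sum>t\<in>?N. g u s t)"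
    by (subst sum.swap[of _ ?N ?N, symmetric], subst (2) sum.swap) (intro sum.cong refl sum.swap)
  also have "(\<Sum>s\<in>?N. \<Sum>t\<in>?N. \<Sum>u\<in>?N. g s t u) =
      4 * (\<Sum>s\<in>?N. \<Sum>t = 1..<l - s. (real (l - (s + t)))\<^sup>2)"
    unfolding sum_distrib_left
  proof (rule sum.cong)
    fix s assume s: "s \<in> ?N"
    \<comment> \<open>Only \<open>u = s + t\<close> survives, and it is in range only when
      \<open>s + t < l\<close>.\<close>
    have "(\<Sum>t\<in>?N. \<Sum>u\<in>?N. g s t u) =
        (\<Sum>t\<in>?N. if s + t < l then 4 * (real (l - (s + t)))\<^sup>2 else 0)"
      using s by (intro sum.cong) (auto simp: g_def)
    also have "\<dots> = (\<Sum>t\<in>{t \<in> ?N. s + t < l}. 4 * (real (l - (s + t)))\<^sup>2)"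
      by (rule sum.inter_filter[symmetric]) simp
    also have "{t \<in> ?N. s + t < l} = {1..<l - s}" by auto
    finally show "(\<Sum>t\<in>?N. \<Sum>u\<in>?N. g s t u) = (\<Sum>t = 1..<l - s. 4 * (real (l - (s + t)))\<^sup>2)" .
  qed simp
  finally show ?thesis using sum_squares_pairs[of l] by simp
qed

section \<open>Expectations over pairs and the third central moment\<close>

lemma pair_expectation_sum:
  "pair_expectation l v = (\<Sum>f\<in>binary_seq l. \<Sum>g\<in>binary_seq l. v f g) / 2 ^ (2 * l)"
  unfolding pair_expectation_def
  by (subst integral_pmf_of_set[OF Pair_seq_nonempty finite_Pair_seq])
    (simp only: card_Pair_seq, simp add: Pair_seq_def sum.cartesian_product)

lemma pair_expectation_cong:
  assumes "\<And>f g. f \<in> binary_seq l \<Longrightarrow> g \<in> binary_seq l \<Longrightarrow> v f g = w f g"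
  shows "pair_expectation l v = pair_expectation l w"
  using assms by (simp add: pair_expectation_sum)

text \<open>This is the independence of two identically distributed sequences: each mixed sum
  factors into a square. The index \<open>x\<close> is a shift for the mean and a triple of shifts
  for the third moment.\<close>

lemma sum_pair_product:
  fixes p :: "'a \<Rightarrow> 'b \<Rightarrow> 'c::comm_semiring_1"
  shows "(\<Sum>f\<in>A. \<Sum>g\<in>A. \<Sum>x\<in>X. p f x * p g x) = (\<Sum>x\<in>X. (\<Sum>f\<in>A. p f x)\<^sup>2)"
proof -
  have "(\<Sum>f\<in>A. \<Sum>g\<in>A. \<Sum>x\<in>X. p f x * p g x) = (\<Sum>f\<in>A. \<Sum>x\<in>X. \<Sum>g\<in>A. p f x * p g x)"
    by (intro sum.cong refl sum.swap)
  also have "\<dots> = (\<Sum>x\<in>X. \<Sum>f\<in>A. \<Sum>g\<in>A. p f x * p g x)"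
    by (rule sum.swap)
  finally show ?thesis by (simp add: power2_eq_square sum_product)
qed

lemma pair_expectation_CDF:
  assumes "l > 0"
  shows "pair_expectation l CDF = 1"
proof -
  let ?B = "binary_seq l"
  have "(\<Sum>f\<in>?B. \<Sum>g\<in>?B. \<Sum>s = 1..<l. autocorr l f s * autocorr l g s) =
      (\<Sum>s = 1..<l. (\<Sum>f\<in>?B. autocorr l f s)\<^sup>2)"
    by (rule sum_pair_product)
  also have "\<dots> = 0" by (simp add: sum_autocorr)
  finally have zero: "(\<Sum>f\<in>?B. \<Sum>g\<in>?B. \<Sum>s = 1..<l. autocorr l f s * autocorr l g s) = 0" .
  have "(\<Sum>f\<in>?B. \<Sum>g\<in>?B. CDF f g) =
      (\<Sum>f\<in>?B. \<Sum>g\<in>?B. 1 + 2 / (real l)\<^sup>2 * (\<Sum>s = 1..<l. autocorr l f s * autocorr l g s))"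
    using assms by (simp add: CDF_binary)
  also have "\<dots> = 2 ^ (2 * l)"
    by (simp only: sum.distrib sum_distrib_left[symmetric] zero)
      (simp add: card_binary_seq power_add[symmetric] mult_2)
  finally show ?thesis by (simp add: pair_expectation_sum)
qed

lemma sum_cube_autocorr:
  "(\<Sum>f\<in>binary_seq l. \<Sum>g\<in>binary_seq l. (\<Sum>s = 1..<l. autocorr l f s * autocorr l g s) ^ 3) =
    2 ^ (2 * l) * (\<Sum>s = 1..<l. \<Sum>t = 1..<l. \<Sum>u = 1..<l. (triple_moment l s t u)\<^sup>2)"
proof -
  let ?B = "binary_seq l" and ?N = "{1..<l}"
  define p where "p f = (\<lambda>(s, t, u). autocorr l f s * autocorr l f t * autocorr l f u)" for f
  have "(\<Sum>s\<in>?N. autocorr l f s * autocorr l g s) ^ 3 =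
      (\<Sum>x\<in>?N \<times> ?N \<times> ?N. p f x * p g x)" for f g
    by (simp add: power3_eq_cube sum_product sum_distrib_left sum_distrib_right p_def ac_simps
        sum.cartesian_product')
  then have "(\<Sum>f\<in>?B. \<Sum>g\<in>?B. (\<Sum>s\<in>?N. autocorr l f s * autocorr l g s) ^ 3) =
      (\<Sum>x\<in>?N \<times> ?N \<times> ?N. (\<Sum>f\<in>?B. p f x)\<^sup>2)"
    by (simp only: sum_pair_product)
  also have "\<dots> = (\<Sum>s\<in>?N. \<Sum>t\<in>?N. \<Sum>u\<in>?N. (\<Sum>f\<in>?B. p f (s, t, u))\<^sup>2)"
    by (simp only: sum.cartesian_product')
  \<comment> \<open>The normalization \<open>2 ^ l\<close> of the moment is squared, which gives the
    number of pairs.\<close>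
  also have "\<dots> = (\<Sum>s\<in>?N. \<Sum>t\<in>?N. \<Sum>u\<in>?N. 2 ^ (2 * l) * (triple_moment l s t u)\<^sup>2)"
    by (intro sum.cong refl)
      (simp add: triple_moment_def p_def power_divide power_mult[symmetric] mult.commute)
  finally show ?thesis by (simp only: sum_distrib_left)
qed

theorem theorem1p3:
  fixes l :: nat
  assumes "l > 0"
  shows "pair_central_moment 3 l CDF =
    (8 * real l ^ 4 - 32 * real l ^ 3 + 40 * real l ^ 2 - 16 * real l) / real l ^ 6"
proof -
  \<comment> \<open>The mean is 1, so the deviation is \<open>2 / l^2\<close> times the sum over
    shifts, and its cube has the constant \<open>8 / l^6\<close>.\<close>
  have "pair_central_moment 3 l CDF = pair_expectation l
      (\<lambda>f g. 8 / real l ^ 6 * (\<Sum>s = 1..<l. autocorr l f s * autocorr l g s) ^ 3)"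
    unfolding pair_central_moment_def pair_expectation_CDF[OF assms]
    using assms
    by (intro pair_expectation_cong)
      (simp add: CDF_binary power_mult_distrib power_divide power_mult[symmetric])
  also have "\<dots> = 8 / real l ^ 6 *
      (\<Sum>s = 1..<l. \<Sum>t = 1..<l. \<Sum>u = 1..<l. (triple_moment l s t u)\<^sup>2)"
    unfolding pair_expectation_sum
    by (simp only: sum_distrib_left[symmetric] sum_cube_autocorr) simp
  also have "\<dots> = 8 / real l ^ 6 * (real l * (real l - 1)\<^sup>2 * (real l - 2))"
    by (simp only: sum_triple_moment_square)
  also have "\<dots> = (8 * real l ^ 4 - 32 * real l ^ 3 + 40 * real l ^ 2 - 16 * real l) / real l ^ 6"
  proof -
    have "8 * (real l * (real l - 1)\<^sup>2 * (real l - 2)) =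
        8 * real l ^ 4 - 32 * real l ^ 3 + 40 * real l ^ 2 - 16 * real l"
      by (simp add: algebra_simps power2_eq_square power3_eq_cube power4_eq_xxxx)
    then show ?thesis by simp
  qed
  finally show ?thesis .
qed

end
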